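(* Let $d\ge 2$, let $\{P_{\alpha,k}: \alpha=1,\dots,N,\ k=1,\dots,M_\alpha\}$ be a generalized equiangular measurement on $\mathbb{C}^d$ with parameters $\gamma_\alpha, a_\alpha, b_\alpha$ (where $a_\alpha = d\gamma_\alpha/M_\alpha$), and let $1\le L\le N$. Let $F=\{P_{\alpha,k}: \alpha=1,\dots,L,\ k=1,\dots,M_\alpha\}$ be the steering functional formed from the first $L$ measurement settings. Then the local hidden state bound of $F$ satisfies $$S_{\mathrm{LHS}}(F)\ \le\ \xi_+ := \frac{1}{d}\left[\sum_{\alpha=1}^L a_\alpha+\sqrt{(d-1)\sum_{\alpha=1}^L a_\alpha^2\,(d\,b_\alpha-1)}\,\right].$$
   Context: Generalized equiangular measurement (GEAM). Let $N\ge 1$ and $M_\alpha\ge 2$ ($\alpha=1,\dots,N$) be integers with $\sum_{\alpha=1}^N M_\alpha=d^2+N-1$. A GEAM on $\mathbb{C}^d$ is a collection of $N$ sets of positive semidefinite operators $\{P_{\alpha,k}\}_{k=1}^{M_\alpha}$ on $\mathbb{C}^d$ such that $\sum_{k=1}^{M_\alpha}P_{\alpha,k}=\gamma_\alpha \mathbb{I}_d$ with $\gamma_\alpha>0$ and $\sum_{\alpha=1}^N\gamma_\alpha=1$, and $$\mathrm{Tr}(P_{\alpha,k})=a_\alpha,\qquad \mathrm{Tr}(P_{\alpha,k}^2)=b_\alpha a_\alpha^2,\qquad \mathrm{Tr}(P_{\alpha,k}P_{\alpha,\ell})=c_\alpha a_\alpha^2\ (k\ne \ell),\qquad \mathrm{Tr}(P_{\alpha,k}P_{\beta,\ell})=f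 a_\alpha a_\beta\ (\alpha\neq\beta),$$ where $$a_\alpha=\frac{d\gamma_\alpha}{M_\alpha},\qquad c_\alpha=\frac{M_\alpha-d b_\alpha}{d(M_\alpha-1)},\qquad f=\frac1d,\qquad \frac1d<b_\alpha\le\frac1d\min\{d,M_\alpha\}.$$ Local hidden state (LHS) assemblages. A family $\sigma=\{\sigma_{\alpha,k}:\alpha=1,\dots,L,\ k=1,\dots,M_\alpha\}$ of $d\times d$ matrices admits an LHS model if there exist a finite index set $\Lambda$, a probability distribution $\{q_\lambda\}_{\lambda\in\Lambda}$, density matrices (positive semidefinite, trace one) $\sigma_\lambda$ on $\mathbb{C}^d$, and, for each $\lambda$ and $\alpha$, a probability distribution $k\mapsto p_\lambda(k|\alpha)$ on $\{1,\dots,M_\alpha\}$, such that $\sigma_{\alpha,k}=\sum_{\lambda\in\Lambda}q_\lambda\,p_\lambda(k|\alpha)\,\sigma_\lambda$ for all $\alpha,k$. The set of all such families is denoted $\mathcal{L}$. Steering functional and LHS bound. A steering functional is a family $F=\{F_{\alpha,k}:\alpha=1,\dots,L,\ k=1,\dots,M_\alpha\}$ of Hermitian $d\times d$ matrices. Its value on $\sigma$ is $\langle F,\sigma\rangle=\mathrm{Tr}\big(\sum_{\alpha=1}^L\sum_{k=1}^{M_\alpha}F_{\alpha,k}\sigma_{\alpha,k}\big)$, and its LHS bound is $S_{\mathrm{LHS}}(F)=\sup_{\sigma\in\mathcal{L}}|\langle F,\sigma\rangle|$. *)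

theory Defs
  imports "HOL-Analysis.Analysis"
begin

text \<open>Operators on the d-dimensional complex space are matrices of type
  \<^typ>\<open>complex^'d^'d\<close> with d = \<^term>\<open>CARD('d)\<close>. Families indexed by a setting
  and an outcome are functions \<^typ>\<open>nat \<Rightarrow> nat \<Rightarrow> complex^'d^'d\<close>. Settings range over
  1..N (or 1..L) and the outcomes of setting \<open>\<alpha>\<close> over \<open>1..M \<alpha>\<close>. Values outside these
  ranges play no role.\<close>

definition hermitian :: "complex^'d^'d \<Rightarrow> bool" where
  "hermitian A \<longleftrightarrow> (\<forall>i j. A $ i $ j = cnj (A $ j $ i))"

text \<open>For Hermitian matrices the quadratic form below is real, so taking its real part loses
  nothing.\<close>

definition psd :: "complex^'d^'d \<Rightarrow> bool" where
  "psd A \<longleftrightarrow> hermitian A \<and> (\<forall>x. 0 \<le> Re (\<Sum>i\<in>UNIV. cnj (x $ i) * (A *v x) $ i))"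

definition density_matrix :: "complex^'d^'d \<Rightarrow> bool" where
  "density_matrix A \<longleftrightarrow> psd A \<and> trace A = 1"

definition prob_dist :: "'i set \<Rightarrow> ('i \<Rightarrow> real) \<Rightarrow> bool" where
  "prob_dist I p \<longleftrightarrow> (\<forall>i\<in>I. 0 \<le> p i) \<and> (\<Sum>i\<in>I. p i) = 1"

definition geam_c :: "nat \<Rightarrow> nat \<Rightarrow> real \<Rightarrow> real" where
  "geam_c d m b = (real m - real d * b) / (real d * (real m - 1))"

definition GEAM ::
  "nat \<Rightarrow> (nat \<Rightarrow> nat) \<Rightarrow> (nat \<Rightarrow> real) \<Rightarrow> (nat \<Rightarrow> real) \<Rightarrow> (nat \<Rightarrow> real)
    \<Rightarrow> (nat \<Rightarrow> nat \<Rightarrow> complex^'d^'d) \<Rightarrow> bool" where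
  "GEAM N M \<gamma> a b P \<longleftrightarrow>
     N \<ge> 1 \<and> (\<forall>\<alpha>\<in>{1..N}. M \<alpha> \<ge> 2) \<and> (\<Sum>\<alpha>=1..N. M \<alpha>) = CARD('d)\<^sup>2 + N - 1 \<and>
     (\<forall>\<alpha>\<in>{1..N}. \<forall>k\<in>{1..M \<alpha>}. psd (P \<alpha> k)) \<and>
     (\<forall>\<alpha>\<in>{1..N}. (\<Sum>k=1..M \<alpha>. P \<alpha> k) = \<gamma> \<alpha> *\<^sub>R mat 1) \<and>
     (\<forall>\<alpha>\<in>{1..N}. \<gamma> \<alpha> > 0) \<and> (\<Sum>\<alpha>=1..N. \<gamma> \<alpha>) = 1 \<and>
     (\<forall>\<alpha>\<in>{1..N}. a \<alpha> = real CARD('d) * \<gamma> \<alpha> / real (M \<alpha>)) \<and>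
     (\<forall>\<alpha>\<in>{1..N}. 1 / real CARD('d) < b \<alpha> \<and>
        b \<alpha> \<le> 1 / real CARD('d) * min (real CARD('d)) (real (M \<alpha>))) \<and>
     (\<forall>\<alpha>\<in>{1..N}. \<forall>k\<in>{1..M \<alpha>}. trace (P \<alpha> k) = of_real (a \<alpha>)) \<and>
     (\<forall>\<alpha>\<in>{1..N}. \<forall>k\<in>{1..M \<alpha>}. trace (P \<alpha> k ** P \<alpha> k) = of_real (b \<alpha> * (a \<alpha>)\<^sup>2)) \<and>
     (\<forall>\<alpha>\<in>{1..N}. \<forall>k\<in>{1..M \<alpha>}. \<forall>l\<in>{1..M \<alpha>}. k \<noteq> l \<longrightarrow>
        trace (P \<alpha> k ** P \<alpha> l) = of_real (geam_c CARD('d) (M \<alpha>) (b \<alpha>) * (a \<alpha>)\<^sup>2)) \<and>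
     (\<forall>\<alpha>\<in>{1..N}. \<forall>\<beta>\<in>{1..N}. \<alpha> \<noteq> \<beta> \<longrightarrow> (\<forall>k\<in>{1..M \<alpha>}. \<forall>l\<in>{1..M \<beta>}.
        trace (P \<alpha> k ** P \<beta> l) = of_real (1 / real CARD('d) * a \<alpha> * a \<beta>)))"

text \<open>Every finite index set of hidden variables is in bijection with a finite set of natural
  numbers, so \<open>\<Lambda>\<close> is taken there.\<close>

definition LHS_assemblages :: "nat \<Rightarrow> (nat \<Rightarrow> nat) \<Rightarrow> (nat \<Rightarrow> nat \<Rightarrow> complex^'d^'d) set" where
  "LHS_assemblages L M =
    {\<sigma>. \<exists>(\<Lambda> :: nat set) q \<rho> p.
          finite \<Lambda> \<and> prob_dist \<Lambda> q \<and>
          (\<forall>x\<in>\<Lambda>. density_matrix (\<rho> x)) \<and>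
          (\<forall>x\<in>\<Lambda>. \<forall>\<alpha>\<in>{1..L}. prob_dist {1..M \<alpha>} (p x \<alpha>)) \<and>
          (\<forall>\<alpha>\<in>{1..L}. \<forall>k\<in>{1..M \<alpha>}. \<sigma> \<alpha> k = (\<Sum>x\<in>\<Lambda>. (q x * p x \<alpha> k) *\<^sub>R \<rho> x))}"

definition steering_functional ::
  "nat \<Rightarrow> (nat \<Rightarrow> nat) \<Rightarrow> (nat \<Rightarrow> nat \<Rightarrow> complex^'d^'d) \<Rightarrow> bool" where
  "steering_functional L M F \<longleftrightarrow> (\<forall>\<alpha>\<in>{1..L}. \<forall>k\<in>{1..M \<alpha>}. hermitian (F \<alpha> k))"

definition steering_value ::
  "nat \<Rightarrow> (nat \<Rightarrow> nat) \<Rightarrow> (nat \<Rightarrow> nat \<Rightarrow> complex^'d^'d) \<Rightarrow> (nat \<Rightarrow> nat \<Rightarrow> complex^'d^'d) \<Rightarrow> complex"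
  where "steering_value L M F \<sigma> = trace (\<Sum>\<alpha>=1..L. \<Sum>k=1..M \<alpha>. F \<alpha> k ** \<sigma> \<alpha> k)"

text \<open>If every \<open>M \<alpha>\<close> is positive, the supremum is over a nonempty bounded set of reals, so
  the real-valued \<^term>\<open>Sup\<close> is the genuine supremum.\<close>

definition LHS_bound :: "nat \<Rightarrow> (nat \<Rightarrow> nat) \<Rightarrow> (nat \<Rightarrow> nat \<Rightarrow> complex^'d^'d) \<Rightarrow> real" where
  "LHS_bound L M F = (SUP \<sigma>\<in>LHS_assemblages L M. cmod (steering_value L M F \<sigma>))"

lemma GEAM_steering_functional:
  assumes "GEAM N M \<gamma> a b P" "L \<le> N"
  shows "steering_functional L M P"
  using assms unfolding GEAM_def steering_functional_def psd_def by simp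

end

theory Submission
  imports Defs
begin

text \<open>
  On Hermitian matrices \<open>Tr (A B)\<close> is the real inner product that \<^typ>\<open>complex^'d^'d\<close> carries
  as a Euclidean space. Subtracting from \<open>P \<alpha> k\<close> its multiple of the identity leaves a vector
  \<open>V \<alpha> k\<close> of squared length \<open>a\<^sup>2 (d b - 1) / d\<close>, and vectors of different settings are
  orthogonal. For a response function \<open>p\<close> the vectors \<open>\<Sum>k. p \<alpha> k V \<alpha> k\<close> are
  convex combinations, so by Pythagoras their sum over \<open>\<alpha>\<close> has squared length at most
  \<open>\<Sum>\<alpha>. a\<^sup>2 (d b - 1) / d\<close>. The traceless part of a density matrix has squared length at most
  \<open>1 - 1 / d\<close>, and Cauchy-Schwarz gives the bound.
\<close>

section \<open>The trace form as a real inner product\<close>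

text \<open>Hermitian symmetry of \<open>B\<close> turns the trace into the sum of
  \<open>A $ i $ j * cnj (B $ i $ j)\<close>. Conjugating this sum only exchanges \<open>i\<close>
  and \<open>j\<close>, so it is real, and its real part is the entrywise inner product.\<close>

lemma inner_hermitian_eq_trace:
  fixes A B :: "complex^'d^'d"
  assumes "hermitian A" "hermitian B"
  shows "trace (A ** B) = of_real (A \<bullet> B)"
proof -
  have A: "A $ j $ i = cnj (A $ i $ j)" and B: "B $ j $ i = cnj (B $ i $ j)" for i j
    using assms unfolding hermitian_def by blast+
  have tr: "trace (A ** B) = (\<Sum>i\<in>UNIV. \<Sum>j\<in>UNIV. A $ i $ j * cnj (B $ i $ j))"
    unfolding trace_def matrix_matrix_mult_def by (simp flip: B)
  have "cnj (trace (A ** B)) = (\<Sum>i\<in>UNIV. \<Sum>j\<in>UNIV. A $ j $ i * cnj (B $ j $ i))"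
    unfolding tr cnj_sum by (intro sum.cong refl) (simp flip: A B)
  also have "\<dots> = trace (A ** B)"
    unfolding tr by (rule sum.swap)
  finally have "trace (A ** B) \<in> \<real>"
    by (simp add: Reals_cnj_iff)
  moreover have "Re (trace (A ** B)) = A \<bullet> B"
    unfolding tr by (simp add: inner_vec_def inner_complex_def)
  ultimately show ?thesis
    by (metis of_real_Re)
qed

lemma trace_eq_inner_mat_1:
  fixes A :: "complex^'d^'d"
  assumes "hermitian A"
  shows "trace A = of_real (A \<bullet> mat 1)"
proof -
  have "hermitian (mat 1 :: complex^'d^'d)"
    by (simp add: hermitian_def mat_def)
  from inner_hermitian_eq_trace[OF assms this] show ?thesis
    by simp
qed

lemma inner_mat_1_mat_1: "(mat 1 :: complex^'d^'d) \<bullet> mat 1 = real CARD('d)"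
proof -
  have "of_real ((mat 1 :: complex^'d^'d) \<bullet> mat 1) = (trace (mat 1 :: complex^'d^'d))"
    by (rule trace_eq_inner_mat_1[symmetric]) (simp add: hermitian_def mat_def)
  also have "\<dots> = of_real (real CARD('d))"
    by (simp add: trace_I)
  finally show ?thesis
    unfolding of_real_eq_iff .
qed

lemma hermitian_scaleR_sum:
  assumes "\<And>x. x \<in> S \<Longrightarrow> hermitian (f x)"
  shows "hermitian (\<Sum>x\<in>S. c x *\<^sub>R f x)"
  unfolding hermitian_def
proof (intro allI)
  fix i j
  have "f x $ i $ j = cnj (f x $ j $ i)" if "x \<in> S" for x
    using assms[OF that] unfolding hermitian_def by blast
  then show "(\<Sum>x\<in>S. c x *\<^sub>R f x) $ i $ j = cnj ((\<Sum>x\<in>S. c x *\<^sub>R f x) $ j $ i)"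
    by simp
qed

section \<open>Positive semidefinite matrices and purity\<close>

text \<open>Nonnegativity of the 2x2 principal minors, obtained by testing the quadratic form on
  vectors supported on one or two coordinates.\<close>

lemma psd_norm_entry_le:
  fixes A :: "complex^'d^'d"
  assumes "psd A"
  shows "0 \<le> Re (A $ i $ i)" "(cmod (A $ i $ j))\<^sup>2 \<le> Re (A $ i $ i) * Re (A $ j $ j)"
proof -
  have herm: "A $ i $ j = cnj (A $ j $ i)" for i j
    using assms unfolding psd_def hermitian_def by blast
  have form: "0 \<le> Re (\<Sum>i\<in>UNIV. cnj (x $ i) * (A *v x) $ i)" for x
    using assms unfolding psd_def by blast
  have diag: "0 \<le> Re (A $ i $ i)" for i
    using form[of "axis i 1"]
    by (simp add: matrix_vector_mult_def axis_def if_distrib if_distribR cong: if_cong)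
  have im: "Im (A $ i $ i) = 0" for i
    using arg_cong[OF herm[of i i], of Im] by simp
  show "0 \<le> Re (A $ i $ i)"
    by (rule diag)
  show "(cmod (A $ i $ j))\<^sup>2 \<le> Re (A $ i $ i) * Re (A $ j $ j)"
  proof (cases "i = j")
    case True
    then show ?thesis
      unfolding cmod_power2 by (simp add: im power2_eq_square)
  next
    case False
    define z where "z = A $ i $ j"
    have ji: "A $ j $ i = cnj z"
      using herm[of j i] by (simp add: z_def)
    have quad: "0 \<le> t\<^sup>2 * Re (A $ i $ i) + Re (A $ j $ j) * (cmod z)\<^sup>2 - 2 * t * (cmod z)\<^sup>2"
      for t
    proof -
      \<comment> \<open>The entry \<open>- cnj z\<close> aligns the phases: both cross terms of the
        form become \<open>- t * (cmod z)\<^sup>2\<close>, leaving a real polynomial in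
        \<open>t\<close>.\<close>
      define x :: "complex^'d" where
        "x = (\<chi> k. if k = i then of_real t else if k = j then - cnj z else 0)"
      have sum_x: "(\<Sum>k\<in>UNIV. g k * x $ k) = g i * of_real t - g j * cnj z" for g
      proof -
        have "(\<Sum>k\<in>UNIV. g k * x $ k) = (\<Sum>k\<in>{i, j}. g k * x $ k)"
          by (rule sum.mono_neutral_right) (auto simp: x_def)
        then show ?thesis
          using False by (simp add: x_def)
      qed
      have sum_cx: "(\<Sum>k\<in>UNIV. cnj (x $ k) * g k) = of_real t * g i - z * g j" for g
      proof -
        have "(\<Sum>k\<in>UNIV. cnj (x $ k) * g k) = (\<Sum>k\<in>{i, j}. cnj (x $ k) * g k)"
          by (rule sum.mono_neutral_right) (auto simp: x_def)
        then show ?thesis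
          using False by (simp add: x_def)
      qed
      have "(\<Sum>k\<in>UNIV. cnj (x $ k) * (A *v x) $ k) =
        of_real t * (A $ i $ i * of_real t - z * cnj z)
          - z * (cnj z * of_real t - A $ j $ j * cnj z)"
        unfolding sum_cx by (simp add: matrix_vector_mult_def sum_x ji flip: z_def)
      moreover have "Re \<dots> = t\<^sup>2 * Re (A $ i $ i) + Re (A $ j $ j) * (cmod z)\<^sup>2
          - 2 * t * (cmod z)\<^sup>2"
        unfolding cmod_power2
        by (simp add: im) (simp add: power2_eq_square algebra_simps)
      ultimately show ?thesis
        using form[of x] by metis
    qed
    show ?thesis
    proof (cases "Re (A $ i $ i) = 0")
      case True
      \<comment> \<open>The form is then affine in \<open>t\<close>, so its slope vanishes.\<close>
      have "cmod z = 0"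
      proof (rule ccontr)
        assume "cmod z \<noteq> 0"
        then have "0 < (cmod z)\<^sup>2"
          by simp
        moreover have "0 \<le> - (cmod z)\<^sup>2 * (Re (A $ j $ j) + 2)"
          using quad[of "Re (A $ j $ j) + 1"] True by (simp add: algebra_simps)
        ultimately show False
          using diag[of j] by (simp add: zero_le_mult_iff mult_le_0_iff)
      qed
      then show ?thesis
        using True by (simp add: z_def)
    next
      case False
      define r where "r = Re (A $ i $ i)"
      have r: "r > 0"
        using False diag[of i] by (simp add: r_def)
      \<comment> \<open>This \<open>t\<close> minimises the quadratic. The common factor
        \<open>(cmod z)\<^sup>2\<close> can be cancelled only when it is nonzero, hence the
        disjunction below.\<close>
      have "0 \<le> r * ((cmod z)\<^sup>2 / r)\<^sup>2 + Re (A $ j $ j) * (cmod z)\<^sup>2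
          - 2 * ((cmod z)\<^sup>2 / r) * (cmod z)\<^sup>2"
        using quad[of "(cmod z)\<^sup>2 / r"] by (simp add: r_def mult.commute)
      also have "\<dots> = (cmod z)\<^sup>2 * (Re (A $ j $ j) - (cmod z)\<^sup>2 / r)"
        using r by (simp add: field_simps power2_eq_square)
      finally have "cmod z = 0 \<or> (cmod z)\<^sup>2 / r \<le> Re (A $ j $ j)"
        by (auto simp: zero_le_mult_iff)
      then show ?thesis
        using r diag[of i] diag[of j] by (auto simp: field_simps r_def z_def)
    qed
  qed
qed

text \<open>Summing the minor bounds over all entries factors the right-hand side into the squared
  trace, so no spectral decomposition is involved. For density matrices it says that the purity is
  at most 1.\<close>

lemma psd_inner_self_le:
  fixes A :: "complex^'d^'d"
  assumes "psd A"
  shows "A \<bullet> A \<le> (Re (trace A))\<^sup>2"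
proof -
  have "A \<bullet> A = (\<Sum>i\<in>UNIV. \<Sum>j\<in>UNIV. (cmod (A $ i $ j))\<^sup>2)"
    by (simp add: inner_vec_def power2_norm_eq_inner)
  also have "\<dots> \<le> (\<Sum>i\<in>UNIV. \<Sum>j\<in>UNIV. Re (A $ i $ i) * Re (A $ j $ j))"
    by (intro sum_mono psd_norm_entry_le assms)
  also have "\<dots> = (Re (trace A))\<^sup>2"
    by (simp add: trace_def power2_eq_square sum_product)
  finally show ?thesis .
qed

lemma density_matrix_inner:
  fixes \<rho> :: "complex^'d^'d"
  assumes "density_matrix \<rho>"
  shows "\<rho> \<bullet> mat 1 = 1" "\<rho> \<bullet> \<rho> \<le> 1"
proof -
  have *: "psd \<rho>" "hermitian \<rho>" "trace \<rho> = 1"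
    using assms by (auto simp: density_matrix_def psd_def)
  show "\<rho> \<bullet> mat 1 = 1"
    using trace_eq_inner_mat_1[OF *(2)] *(3) by (metis of_real_eq_1_iff)
  show "\<rho> \<bullet> \<rho> \<le> 1"
    using psd_inner_self_le[OF *(1)] *(3) by simp
qed

section \<open>Existence of an LHS assemblage\<close>

lemma density_matrix_maximally_mixed:
  "density_matrix ((1 / real CARD('d)) *\<^sub>R (mat 1 :: complex^'d^'d))"
proof -
  have "(((1 / real CARD('d)) *\<^sub>R (mat 1 :: complex^'d^'d)) *v x)
      = (1 / real CARD('d)) *\<^sub>R x" for x
    by (simp add: vec_eq_iff matrix_vector_mult_def mat_def if_distrib if_distribR cong: if_cong)
  moreover have "0 \<le> Re (\<Sum>i\<in>UNIV. cnj (x $ i) * ((1 / real CARD('d)) *\<^sub>R x) $ i)"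
    for x :: "complex^'d"
    by (simp add: sum_nonneg flip: distrib_left add_divide_distrib)
  ultimately have "psd ((1 / real CARD('d)) *\<^sub>R (mat 1 :: complex^'d^'d))"
    by (simp add: psd_def hermitian_def mat_def)
  moreover have "trace ((1 / real CARD('d)) *\<^sub>R (mat 1 :: complex^'d^'d)) = 1"
    by (simp add: trace_def mat_def) (simp add: scaleR_conv_of_real)
  ultimately show ?thesis
    by (simp add: density_matrix_def)
qed

text \<open>Needed to bound the real-valued supremum. The witness has one hidden variable, the
  maximally mixed state, and the deterministic response 1 in every setting.\<close>

lemma LHS_assemblages_nonempty:
  assumes "\<And>\<alpha>. \<alpha> \<in> {1..L} \<Longrightarrow> M \<alpha> \<ge> 1"
  shows "(LHS_assemblages L M :: (nat \<Rightarrow> nat \<Rightarrow> complex^'d^'d) set) \<noteq> {}"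
proof -
  define \<rho> :: "complex^'d^'d" where "\<rho> = (1 / real CARD('d)) *\<^sub>R mat 1"
  define p :: "nat \<Rightarrow> real" where "p k = (if k = 1 then 1 else 0)" for k
  have "prob_dist {1..M \<alpha>} p" if "\<alpha> \<in> {1..L}" for \<alpha>
    using assms[OF that] by (simp add: prob_dist_def p_def)
  then have "(\<lambda>\<alpha> k. p k *\<^sub>R \<rho>) \<in> LHS_assemblages L M"
    using density_matrix_maximally_mixed
    unfolding LHS_assemblages_def \<rho>_def
    by (intro CollectI exI[of _ "{0}"] exI[of _ "\<lambda>_. 1"]
        exI[of _ "\<lambda>_. (1 / real CARD('d)) *\<^sub>R mat 1"] exI[of _ "\<lambda>_ _. p"])
      (auto simp: prob_dist_def)
  then show ?thesis
    by blast
qed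

section \<open>The bound for a single hidden state\<close>

text \<open>Serves two averages: over the outcomes of one setting, for matrices, and over the hidden
  variables, for real numbers.\<close>

lemma convex_combination_norm_le:
  fixes V :: "'i \<Rightarrow> 'a::real_normed_vector"
  assumes "prob_dist K p" "\<And>k. k \<in> K \<Longrightarrow> norm (V k) \<le> s"
  shows "norm (\<Sum>k\<in>K. p k *\<^sub>R V k) \<le> s"
proof -
  have "norm (\<Sum>k\<in>K. p k *\<^sub>R V k) \<le> (\<Sum>k\<in>K. p k * s)"
    using assms by (intro sum_norm_le) (auto simp: prob_dist_def intro!: mult_left_mono)
  also have "\<dots> = s"
    using assms(1) by (simp add: prob_dist_def flip: sum_distrib_right)
  finally show ?thesis .
qed

lemma GEAM_response_inner_density_le:
  fixes P :: "nat \<Rightarrow> nat \<Rightarrow> complex^'d^'d"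
  assumes G: "GEAM N M \<gamma> a b P" and "L \<le> N" and \<rho>: "density_matrix \<rho>"
    and p: "\<And>\<alpha>. \<alpha> \<in> {1..L} \<Longrightarrow> prob_dist {1..M \<alpha>} (p \<alpha>)"
  shows "\<bar>(\<Sum>\<alpha>=1..L. \<Sum>k=1..M \<alpha>. p \<alpha> k *\<^sub>R P \<alpha> k) \<bullet> \<rho>\<bar> \<le>
    1 / real CARD('d) * ((\<Sum>\<alpha>=1..L. a \<alpha>)
      + sqrt ((real CARD('d) - 1) * (\<Sum>\<alpha>=1..L. (a \<alpha>)\<^sup>2 * (real CARD('d) * b \<alpha> - 1))))"
proof -
  define d where "d = real CARD('d)"
  define I where "I = (mat 1 :: complex^'d^'d)"
  \<comment> \<open>The coefficient is the quotient of \<open>P \<alpha> k \<bullet> I\<close> and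
    \<open>I \<bullet> I\<close>, so the component along the identity is removed.\<close>
  define V where "V \<alpha> k = P \<alpha> k - (a \<alpha> / d) *\<^sub>R I" for \<alpha> k
  define Q where "Q \<alpha> = (\<Sum>k=1..M \<alpha>. p \<alpha> k *\<^sub>R V \<alpha> k)" for \<alpha>
  define R where "R = \<rho> - (1 / d) *\<^sub>R I"
  define s where "s \<alpha> = (a \<alpha>)\<^sup>2 * (d * b \<alpha> - 1)" for \<alpha>
  have d: "d > 0"
    by (simp add: d_def)
  have II: "I \<bullet> I = d"
    by (simp add: I_def d_def inner_mat_1_mat_1)
  have herm: "hermitian (P \<alpha> k)" if "\<alpha> \<in> {1..L}" "k \<in> {1..M \<alpha>}" for \<alpha> k
    using GEAM_steering_functional[OF G \<open>L \<le> N\<close>] that by (simp add: steering_functional_def)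
  have PI: "P \<alpha> k \<bullet> I = a \<alpha>" if "\<alpha> \<in> {1..L}" "k \<in> {1..M \<alpha>}" for \<alpha> k
  proof -
    have "trace (P \<alpha> k) = of_real (a \<alpha>)"
      using G that \<open>L \<le> N\<close> unfolding GEAM_def by auto
    then show ?thesis
      using trace_eq_inner_mat_1[OF herm[OF that]] by (simp add: I_def)
  qed
  have PP: "P \<alpha> k \<bullet> P \<alpha> k = b \<alpha> * (a \<alpha>)\<^sup>2" if "\<alpha> \<in> {1..L}" "k \<in> {1..M \<alpha>}" for \<alpha> k
  proof -
    have "trace (P \<alpha> k ** P \<alpha> k) = of_real (b \<alpha> * (a \<alpha>)\<^sup>2)"
      using G that \<open>L \<le> N\<close> unfolding GEAM_def by auto
    then show ?thesis
      unfolding inner_hermitian_eq_trace[OF herm[OF that] herm[OF that]] of_real_eq_iff .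
  qed
  have PP': "P \<alpha> k \<bullet> P \<beta> l = 1 / d * a \<alpha> * a \<beta>"
    if "\<alpha> \<in> {1..L}" "k \<in> {1..M \<alpha>}" "\<beta> \<in> {1..L}" "l \<in> {1..M \<beta>}" "\<alpha> \<noteq> \<beta>" for \<alpha> \<beta> k l
  proof -
    have "\<alpha> \<in> {1..N}" "\<beta> \<in> {1..N}"
      using that \<open>L \<le> N\<close> by auto
    then have "trace (P \<alpha> k ** P \<beta> l) = of_real (1 / d * a \<alpha> * a \<beta>)"
      using G that unfolding GEAM_def d_def by blast
    then show ?thesis
      unfolding inner_hermitian_eq_trace[OF herm[OF that(1,2)] herm[OF that(3,4)]]
        of_real_eq_iff .
  qed
  have a0: "a \<alpha> \<ge> 0" if "\<alpha> \<in> {1..L}" for \<alpha>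
  proof -
    have "\<alpha> \<in> {1..N}"
      using that \<open>L \<le> N\<close> by auto
    then have "a \<alpha> = d * \<gamma> \<alpha> / real (M \<alpha>) \<and> \<gamma> \<alpha> > 0"
      using G unfolding GEAM_def d_def by auto
    then show ?thesis
      using d by simp
  qed
  have VI: "V \<alpha> k \<bullet> I = 0" if "\<alpha> \<in> {1..L}" "k \<in> {1..M \<alpha>}" for \<alpha> k
    using PI[OF that] d by (simp add: V_def inner_diff_left II)
  have VV: "norm (V \<alpha> k) \<le> sqrt (s \<alpha> / d)" if "\<alpha> \<in> {1..L}" "k \<in> {1..M \<alpha>}" for \<alpha> k
  proof -
    have "V \<alpha> k \<bullet> V \<alpha> k = s \<alpha> / d"
      using PI[OF that] PP[OF that] d
      by (simp add: V_def s_def inner_diff_left inner_diff_right inner_commute[of I "P _ _"] II)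
        (simp add: field_simps power2_eq_square)
    then show ?thesis
      by (simp add: norm_eq_sqrt_inner)
  qed
  \<comment> \<open>The overlap parameter 1/d is exactly what the identity components of two
    settings contribute, so nothing remains.\<close>
  have VV': "V \<alpha> k \<bullet> V \<beta> l = 0"
    if "\<alpha> \<in> {1..L}" "k \<in> {1..M \<alpha>}" "\<beta> \<in> {1..L}" "l \<in> {1..M \<beta>}" "\<alpha> \<noteq> \<beta>" for \<alpha> \<beta> k l
    using PI[OF that(1,2)] PI[OF that(3,4)] PP'[OF that] d
    by (simp add: V_def inner_diff_left inner_diff_right inner_commute[of I "P _ _"] II)
  have Q_norm: "(norm (Q \<alpha>))\<^sup>2 \<le> s \<alpha> / d" if "\<alpha> \<in> {1..L}" for \<alpha>
  proof -
    have "norm (Q \<alpha>) \<le> sqrt (s \<alpha> / d)"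
      unfolding Q_def by (intro convex_combination_norm_le p VV that)
    \<comment> \<open>Since \<open>sqrt\<close> is negative on negative reals, a nonnegative lower
      bound for the root forces its argument to be nonnegative. This is needed to square the
      root.\<close>
    moreover from this have "0 \<le> s \<alpha> / d"
      using norm_ge_zero[of "Q \<alpha>"] real_sqrt_ge_0_iff by (meson order_trans)
    ultimately show ?thesis
      using power_mono[of "norm (Q \<alpha>)" "sqrt (s \<alpha> / d)" 2] by simp
  qed
  have "pairwise (\<lambda>\<alpha> \<beta>. orthogonal (Q \<alpha>) (Q \<beta>)) {1..L}"
    unfolding pairwise_def orthogonal_def Q_def
    by (auto simp: inner_sum_left inner_sum_right VV' intro!: sum.neutral)
  then have "(norm (\<Sum>\<alpha>=1..L. Q \<alpha>))\<^sup>2 = (\<Sum>\<alpha>=1..L. (norm (Q \<alpha>))\<^sup>2)"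
    by (intro norm_sum_Pythagorean) auto
  also have "\<dots> \<le> (\<Sum>\<alpha>=1..L. s \<alpha> / d)"
    by (intro sum_mono Q_norm)
  finally have sum_Q: "(norm (\<Sum>\<alpha>=1..L. Q \<alpha>))\<^sup>2 \<le> (\<Sum>\<alpha>=1..L. s \<alpha>) / d"
    by (simp add: sum_divide_distrib)
  have "(norm R)\<^sup>2 = \<rho> \<bullet> \<rho> - 1 / d"
    using density_matrix_inner(1)[OF \<rho>] d
    by (simp add: power2_norm_eq_inner R_def inner_diff_left inner_diff_right
        inner_commute[of I \<rho>] II flip: I_def)
  then have R: "(norm R)\<^sup>2 \<le> (d - 1) / d"
    using density_matrix_inner(2)[OF \<rho>] d by (simp add: diff_divide_distrib)
  have "((\<Sum>\<alpha>=1..L. Q \<alpha>) \<bullet> R)\<^sup>2 \<le> (norm (\<Sum>\<alpha>=1..L. Q \<alpha>))\<^sup>2 * (norm R)\<^sup>2"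
    by (metis Cauchy_Schwarz_ineq power2_norm_eq_inner)
  also have "\<dots> \<le> (\<Sum>\<alpha>=1..L. s \<alpha>) / d * ((d - 1) / d)"
    using sum_Q R by (intro mult_mono) (auto intro: order_trans[OF zero_le_power2])
  also have "\<dots> = (d - 1) * (\<Sum>\<alpha>=1..L. s \<alpha>) / d\<^sup>2"
    by (simp add: power2_eq_square)
  finally have "\<bar>(\<Sum>\<alpha>=1..L. Q \<alpha>) \<bullet> R\<bar> \<le> sqrt ((d - 1) * (\<Sum>\<alpha>=1..L. s \<alpha>) / d\<^sup>2)"
    using real_le_rsqrt by (metis power2_abs)
  then have QR: "\<bar>(\<Sum>\<alpha>=1..L. Q \<alpha>) \<bullet> R\<bar> \<le> 1 / d * sqrt ((d - 1) * (\<Sum>\<alpha>=1..L. s \<alpha>))"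
    using d by (simp add: real_sqrt_divide)
  \<comment> \<open>The probabilities sum to 1, so the identity component does not depend on the
    response.\<close>
  have sum_PV: "(\<Sum>k=1..M \<alpha>. p \<alpha> k *\<^sub>R P \<alpha> k) = Q \<alpha> + (a \<alpha> / d) *\<^sub>R I"
    if "\<alpha> \<in> {1..L}" for \<alpha>
  proof -
    have "(\<Sum>k=1..M \<alpha>. p \<alpha> k *\<^sub>R P \<alpha> k)
        = (\<Sum>k=1..M \<alpha>. p \<alpha> k *\<^sub>R V \<alpha> k + p \<alpha> k *\<^sub>R (a \<alpha> / d) *\<^sub>R I)"
      by (simp add: V_def algebra_simps)
    also have "\<dots> = Q \<alpha> + (\<Sum>k=1..M \<alpha>. p \<alpha> k) *\<^sub>R (a \<alpha> / d) *\<^sub>R I"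
      unfolding sum.distrib Q_def scaleR_sum_left ..
    finally show ?thesis
      using p[OF that] by (simp add: prob_dist_def)
  qed
  have "(\<Sum>\<alpha>=1..L. \<Sum>k=1..M \<alpha>. p \<alpha> k *\<^sub>R P \<alpha> k)
      = (\<Sum>\<alpha>=1..L. Q \<alpha>) + ((\<Sum>\<alpha>=1..L. a \<alpha>) / d) *\<^sub>R I"
    unfolding sum_divide_distrib scaleR_sum_left sum.distrib[symmetric]
    by (intro sum.cong refl sum_PV)
  \<comment> \<open>By this orthogonality the traceless part sees only \<open>R\<close>, while the
    identity part sees only the unit trace of \<rho>.\<close>
  moreover have "(\<Sum>\<alpha>=1..L. Q \<alpha>) \<bullet> I = 0"
    unfolding Q_def by (auto simp: inner_sum_left VI intro!: sum.neutral)
  moreover have "I \<bullet> \<rho> = 1"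
    using density_matrix_inner(1)[OF \<rho>] by (simp add: I_def inner_commute)
  ultimately have "(\<Sum>\<alpha>=1..L. \<Sum>k=1..M \<alpha>. p \<alpha> k *\<^sub>R P \<alpha> k) \<bullet> \<rho>
      = (\<Sum>\<alpha>=1..L. Q \<alpha>) \<bullet> R + (\<Sum>\<alpha>=1..L. a \<alpha>) / d"
    by (simp add: R_def inner_diff_right inner_add_left)
  \<comment> \<open>The sign lets this constant leave the absolute value unchanged in the triangle
    inequality.\<close>
  moreover have "0 \<le> (\<Sum>\<alpha>=1..L. a \<alpha>) / d"
    using d by (intro divide_nonneg_pos sum_nonneg a0) auto
  ultimately have "\<bar>(\<Sum>\<alpha>=1..L. \<Sum>k=1..M \<alpha>. p \<alpha> k *\<^sub>R P \<alpha> k) \<bullet> \<rho>\<bar>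
      \<le> 1 / d * ((\<Sum>\<alpha>=1..L. a \<alpha>) + sqrt ((d - 1) * (\<Sum>\<alpha>=1..L. s \<alpha>)))"
    using QR by (simp add: distrib_left)
  then show ?thesis
    by (simp add: s_def d_def)
qed

section \<open>Averaging over the hidden variables\<close>

text \<open>By linearity, moving the sum over hidden variables outermost makes the value a
  \<open>q\<close>-average of single-state terms. Each is an inner product and hence real.\<close>

lemma steering_value_LHS:
  assumes F: "steering_functional L M F"
    and \<rho>: "\<And>x. x \<in> \<Lambda> \<Longrightarrow> hermitian (\<rho> x)"
    and \<sigma>: "\<And>\<alpha> k. \<alpha> \<in> {1..L} \<Longrightarrow> k \<in> {1..M \<alpha>} \<Longrightarrow>
      \<sigma> \<alpha> k = (\<Sum>x\<in>\<Lambda>. (q x * p x \<alpha> k) *\<^sub>R \<rho> x)"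
  shows "steering_value L M F \<sigma> =
    of_real (\<Sum>x\<in>\<Lambda>. q x * ((\<Sum>\<alpha>=1..L. \<Sum>k=1..M \<alpha>. p x \<alpha> k *\<^sub>R F \<alpha> k) \<bullet> \<rho> x))"
proof -
  have trace_sum: "trace (\<Sum>i\<in>S. f i) = (\<Sum>i\<in>S. trace (f i))"
    for S :: "nat set" and f :: "nat \<Rightarrow> complex^'a^'a"
    unfolding trace_def by (simp add: sum.swap[of _ UNIV])
  have "steering_value L M F \<sigma> = (\<Sum>\<alpha>=1..L. \<Sum>k=1..M \<alpha>. trace (F \<alpha> k ** \<sigma> \<alpha> k))"
    by (simp add: steering_value_def trace_sum)
  also have "\<dots> = (\<Sum>\<alpha>=1..L. \<Sum>k=1..M \<alpha>. of_real (F \<alpha> k \<bullet> \<sigma> \<alpha> k))"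
  proof (intro sum.cong refl inner_hermitian_eq_trace)
    fix \<alpha> k assume *: "\<alpha> \<in> {1..L}" "k \<in> {1..M \<alpha>}"
    show "hermitian (F \<alpha> k)"
      using F * by (simp add: steering_functional_def)
    show "hermitian (\<sigma> \<alpha> k)"
      unfolding \<sigma>[OF *] by (intro hermitian_scaleR_sum \<rho>)
  qed
  also have "\<dots> = of_real (\<Sum>\<alpha>=1..L. \<Sum>k=1..M \<alpha>. \<Sum>x\<in>\<Lambda>. q x * (p x \<alpha> k * (F \<alpha> k \<bullet> \<rho> x)))"
    by (simp add: \<sigma> inner_sum_right mult.assoc)
  also have "(\<Sum>\<alpha>=1..L. \<Sum>k=1..M \<alpha>. \<Sum>x\<in>\<Lambda>. q x * (p x \<alpha> k * (F \<alpha> k \<bullet> \<rho> x)))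
      = (\<Sum>x\<in>\<Lambda>. \<Sum>\<alpha>=1..L. \<Sum>k=1..M \<alpha>. q x * (p x \<alpha> k * (F \<alpha> k \<bullet> \<rho> x)))"
    by (subst sum.swap[of _ \<Lambda>]) (intro sum.cong refl sum.swap)
  finally show ?thesis
    by (simp add: inner_sum_left sum_distrib_left)
qed

theorem mainTheorem1:
  fixes P :: "nat \<Rightarrow> nat \<Rightarrow> complex^'d^'d"
    and M :: "nat \<Rightarrow> nat" and \<gamma> a b :: "nat \<Rightarrow> real" and N L :: nat
  assumes "CARD('d) \<ge> 2"
    and "GEAM N M \<gamma> a b P"
    and "1 \<le> L" and "L \<le> N"
  shows "LHS_bound L M P \<le>
    1 / real CARD('d) * ((\<Sum>\<alpha>=1..L. a \<alpha>)
      + sqrt ((real CARD('d) - 1) * (\<Sum>\<alpha>=1..L. (a \<alpha>)\<^sup>2 * (real CARD('d) * b \<alpha> - 1))))"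
    (is "_ \<le> ?\<xi>")
  unfolding LHS_bound_def
proof (rule cSUP_least)
  have "M \<alpha> \<ge> 2" if "\<alpha> \<in> {1..L}" for \<alpha>
    using assms(2,4) that unfolding GEAM_def by auto
  then show "(LHS_assemblages L M :: (nat \<Rightarrow> nat \<Rightarrow> complex^'d^'d) set) \<noteq> {}"
    by (intro LHS_assemblages_nonempty) fastforce
next
  fix \<sigma> :: "nat \<Rightarrow> nat \<Rightarrow> complex^'d^'d"
  assume "\<sigma> \<in> LHS_assemblages L M"
  then obtain \<Lambda> :: "nat set" and q \<rho> p where q: "prob_dist \<Lambda> q"
    and \<rho>: "\<And>x. x \<in> \<Lambda> \<Longrightarrow> density_matrix (\<rho> x)"
    and p: "\<And>x \<alpha>. x \<in> \<Lambda> \<Longrightarrow> \<alpha> \<in> {1..L} \<Longrightarrow> prob_dist {1..M \<alpha>} (p x \<alpha>)"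
    and \<sigma>: "\<And>\<alpha> k. \<alpha> \<in> {1..L} \<Longrightarrow> k \<in> {1..M \<alpha>} \<Longrightarrow>
      \<sigma> \<alpha> k = (\<Sum>x\<in>\<Lambda>. (q x * p x \<alpha> k) *\<^sub>R \<rho> x)"
    unfolding LHS_assemblages_def by blast
  define B where "B x = (\<Sum>\<alpha>=1..L. \<Sum>k=1..M \<alpha>. p x \<alpha> k *\<^sub>R P \<alpha> k) \<bullet> \<rho> x" for x
  have "steering_value L M P \<sigma> = of_real (\<Sum>x\<in>\<Lambda>. q x * B x)"
    unfolding B_def
    using \<rho> by (intro steering_value_LHS GEAM_steering_functional[OF assms(2,4)] \<sigma>)
      (auto simp: density_matrix_def psd_def)
  then have "cmod (steering_value L M P \<sigma>) = norm (\<Sum>x\<in>\<Lambda>. q x *\<^sub>R B x)"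
    by (simp only: norm_of_real real_norm_def real_scaleR_def)
  also have "\<dots> \<le> ?\<xi>"
  \<comment> \<open>The single-state bound is uniform in the hidden variable, so the average with
    weights \<open>q\<close> inherits it.\<close>
  proof (rule convex_combination_norm_le[OF q])
    show "norm (B x) \<le> ?\<xi>" if "x \<in> \<Lambda>" for x
      unfolding B_def real_norm_def
      using GEAM_response_inner_density_le[OF assms(2,4) \<rho>[OF that] p[OF that]] .
  qed
  finally show "cmod (steering_value L M P \<sigma>) \<le> ?\<xi>" .
qed

end
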